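(* Let $G$ be any graph. Then $\gamma_R(\mu(G))=\gamma_R(G)+1$ if and only if $G$ is a special Roman graph.
   Context: All graphs are finite and simple. A Roman dominating function (RDF) of $G=(V,E)$ is a function $f:V\to\{0,1,2\}$ such that every vertex $v$ with $f(v)=0$ has a neighbor $w$ with $f(w)=2$; its weight is $\sum_v f(v)$, $\gamma_R(G)$ is the minimum weight of an RDF, and a $\gamma_R$-function is an RDF of weight $\gamma_R(G)$. Write $f=(V_0,V_1,V_2)$ with $V_i=\{v:f(v)=i\}$. $G$ is a special Roman graph if it has a $\gamma_R$-function $f=(V_0,V_1,V_2)$ with $V_1=\emptyset$ such that $G[V_2]$ has no isolated vertex. The Mycielskian $\mu(G)$ of $G$ with $V(G)=\{v_1^0,\ldots,v_n^0\}$ has vertex set $\{v_j^0\}\cup\{v_j^1\}\cup\{u\}$ and edge set $E(G)\cup\{v_j^0v_{j'}^1 : v_j^0v_{j'}^0\in E(G)\}\cup\{v_j^1u: 1\leq j\leq n\}$. *)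

theory Defs
  imports "Graph_Theory.Graph_Theory"
begin

text \<open>
  A finite simple graph is a finite, loop-free, symmetric digraph without parallel arcs,
  i.e. an instance of \<^locale>\<open>pair_graph\<close>: an undirected edge \<open>vw\<close> is the pair
  of arcs \<open>(v, w)\<close> and \<open>(w, v)\<close>.  The graph without vertices is included.
\<close>

text \<open>Values of \<open>f\<close> outside the vertex set are irrelevant, here and in all notions below.\<close>

definition roman_dominating :: "'a pair_pre_digraph \<Rightarrow> ('a \<Rightarrow> nat) \<Rightarrow> bool" where
  "roman_dominating G f \<longleftrightarrow>
     (\<forall>v\<in>pverts G. f v \<in> {0, 1, 2}) \<and>
     (\<forall>v\<in>pverts G. f v = 0 \<longrightarrow> (\<exists>w\<in>pverts G. v \<rightarrow>\<^bsub>G\<^esub> w \<and> f w = 2))"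

definition roman_weight :: "'a pair_pre_digraph \<Rightarrow> ('a \<Rightarrow> nat) \<Rightarrow> nat" where
  "roman_weight G f = (\<Sum>v\<in>pverts G. f v)"

definition roman_number :: "'a pair_pre_digraph \<Rightarrow> nat" where
  "roman_number G = (LEAST k. \<exists>f. roman_dominating G f \<and> roman_weight G f = k)"

definition minimum_roman_dominating :: "'a pair_pre_digraph \<Rightarrow> ('a \<Rightarrow> nat) \<Rightarrow> bool" where
  "minimum_roman_dominating G f \<longleftrightarrow>
     roman_dominating G f \<and> roman_weight G f = roman_number G"

definition roman_part :: "'a pair_pre_digraph \<Rightarrow> ('a \<Rightarrow> nat) \<Rightarrow> nat \<Rightarrow> 'a set" where
  "roman_part G f i = {v \<in> pverts G. f v = i}"

definition isolated_vertex :: "('a, 'b) pre_digraph \<Rightarrow> 'a \<Rightarrow> bool" where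
  "isolated_vertex H v \<longleftrightarrow> v \<in> verts H \<and> \<not> (\<exists>w. v \<rightarrow>\<^bsub>H\<^esub> w \<or> w \<rightarrow>\<^bsub>H\<^esub> v)"

definition special_roman_graph :: "'a pair_pre_digraph \<Rightarrow> bool" where
  "special_roman_graph G \<longleftrightarrow>
     (\<exists>f. minimum_roman_dominating G f \<and> roman_part G f 1 = {} \<and>
          (\<nexists>v. isolated_vertex (with_proj G \<restriction> roman_part G f 2) v))"

text \<open>
  \<open>Base v\<close> and \<open>Shadow v\<close> are the level-0 and level-1 copies of the vertex \<open>v\<close>.
\<close>

datatype 'a mvertex = Base 'a | Shadow 'a | Apex

definition mycielskian :: "'a pair_pre_digraph \<Rightarrow> 'a mvertex pair_pre_digraph" where
  "mycielskian G =
     \<lparr> pverts = Base ` pverts G \<union> Shadow ` pverts G \<union> {Apex},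
       parcs =
         (let E = {(Base v, Base w) | v w. (v, w) \<in> parcs G}
                \<union> {(Base v, Shadow w) | v w. (v, w) \<in> parcs G}
                \<union> {(Shadow v, Apex) | v. v \<in> pverts G}
          in E \<union> E\<inverse>) \<rparr>"

lemma pair_graph_mycielskian:
  assumes "pair_graph G"
  shows "pair_graph (mycielskian G)"
proof -
  interpret pair_graph G by fact
  let ?V = "pverts (mycielskian G)"
  have fin: "finite ?V"
    by (simp add: mycielskian_def pair_finite_verts)
  have sub: "parcs (mycielskian G) \<subseteq> ?V \<times> ?V"
    by (auto simp: mycielskian_def Let_def dest: in_arcsD1 in_arcsD2)
  have "symmetric (with_proj (mycielskian G))"
    unfolding symmetric_def with_proj_simps by (auto simp: mycielskian_def Let_def sym_def)
  moreover have "fst e \<noteq> snd e" if "e \<in> parcs (mycielskian G)" for e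
    using that by (auto simp: mycielskian_def Let_def dest: pair_no_loops)
  ultimately show ?thesis
    using sub fin finite_subset[OF sub] by unfold_locales auto
qed

lemma minimum_roman_dominating_exists: "\<exists>f. minimum_roman_dominating G f"
proof -
  have "roman_dominating G (\<lambda>_. 1)"
    by (simp add: roman_dominating_def)
  then have "\<exists>k f. roman_dominating G f \<and> roman_weight G f = k"
    by blast
  from LeastI_ex[OF this] show ?thesis
    unfolding minimum_roman_dominating_def roman_number_def by blast
qed

end

theory Submission
  imports Defs
begin

text \<open>
  An RDF \<open>f\<close> of \<open>G\<close> witnessing that \<open>G\<close> is special extends to \<open>\<mu>(G)\<close> by \<open>0\<close> on the shadows and \<open>1\<close> on
  the apex. Conversely let \<open>g\<close> be an RDF of \<open>\<mu>(G)\<close>. If \<open>g\<close> is \<open>2\<close> on the apex, the pointwise maximum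
  of base and shadow values is an RDF of \<open>G\<close> of weight at most \<open>w(g) - 2\<close>. Otherwise every shadow of
  value \<open>0\<close> has a base neighbour of value \<open>2\<close>; let \<open>T\<close> be the set of vertices whose base value is
  \<open>2\<close>, and let \<open>h\<close> be \<open>2\<close> on \<open>T\<close>, \<open>0\<close> on the remaining vertices with a neighbour in \<open>T\<close>, and \<open>1\<close>
  elsewhere. Then \<open>h\<close> is an RDF of \<open>G\<close>, pointwise below the sum of base and shadow values. If the
  apex has value \<open>0\<close>, some shadow has value \<open>2\<close> and the slack in this bound is at least \<open>2\<close>; if it
  has value \<open>1\<close>, either there is slack or \<open>h\<close> shows that \<open>G\<close> is special.
\<close>

lemma roman_number_le_weight: "roman_dominating G f \<Longrightarrow> roman_number G \<le> roman_weight G f"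
  unfolding roman_number_def by (rule Least_le) blast

lemma pverts_mycielskian: "pverts (mycielskian G) = Base ` pverts G \<union> Shadow ` pverts G \<union> {Apex}"
  by (simp add: mycielskian_def)

lemma parcs_mycielskian:
  assumes "pair_graph G"
  shows "(Base v, Base w) \<in> parcs (mycielskian G) \<longleftrightarrow> (v, w) \<in> parcs G"
    "(Base v, Shadow w) \<in> parcs (mycielskian G) \<longleftrightarrow> (v, w) \<in> parcs G"
    "(Shadow v, Base w) \<in> parcs (mycielskian G) \<longleftrightarrow> (v, w) \<in> parcs G"
    "(Shadow v, Shadow w) \<notin> parcs (mycielskian G)"
    "(Base v, Apex) \<notin> parcs (mycielskian G)"
    "(Apex, Base v) \<notin> parcs (mycielskian G)"
    "(Shadow v, Apex) \<in> parcs (mycielskian G) \<longleftrightarrow> v \<in> pverts G"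
    "(Apex, Shadow v) \<in> parcs (mycielskian G) \<longleftrightarrow> v \<in> pverts G"
    "(Apex, Apex) \<notin> parcs (mycielskian G)"
proof -
  interpret pair_graph G by fact
  have "(v, w) \<in> parcs G \<longleftrightarrow> (w, v) \<in> parcs G" for v w
    using arcs_symmetric by blast
  then show "(Base v, Base w) \<in> parcs (mycielskian G) \<longleftrightarrow> (v, w) \<in> parcs G"
    "(Base v, Shadow w) \<in> parcs (mycielskian G) \<longleftrightarrow> (v, w) \<in> parcs G"
    "(Shadow v, Base w) \<in> parcs (mycielskian G) \<longleftrightarrow> (v, w) \<in> parcs G"
    "(Shadow v, Shadow w) \<notin> parcs (mycielskian G)"
    "(Base v, Apex) \<notin> parcs (mycielskian G)"
    "(Apex, Base v) \<notin> parcs (mycielskian G)"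
    "(Shadow v, Apex) \<in> parcs (mycielskian G) \<longleftrightarrow> v \<in> pverts G"
    "(Apex, Shadow v) \<in> parcs (mycielskian G) \<longleftrightarrow> v \<in> pverts G"
    "(Apex, Apex) \<notin> parcs (mycielskian G)"
    by (auto simp: mycielskian_def Let_def)
qed

lemma roman_dominating_mycielskian_iff:
  assumes "pair_graph G"
  shows "roman_dominating (mycielskian G) g \<longleftrightarrow>
    (\<forall>v\<in>pverts G. g (Base v) \<le> 2 \<and> g (Shadow v) \<le> 2) \<and> g Apex \<le> 2 \<and>
    (\<forall>v\<in>pverts G. g (Base v) = 0 \<longrightarrow>
      (\<exists>w\<in>pverts G. (v, w) \<in> parcs G \<and> (g (Base w) = 2 \<or> g (Shadow w) = 2))) \<and>
    (\<forall>v\<in>pverts G. g (Shadow v) = 0 \<longrightarrow>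
      g Apex = 2 \<or> (\<exists>w\<in>pverts G. (v, w) \<in> parcs G \<and> g (Base w) = 2)) \<and>
    (g Apex = 0 \<longrightarrow> (\<exists>w\<in>pverts G. g (Shadow w) = 2))"
proof -
  have le2: "n = 0 \<or> n = Suc 0 \<or> n = 2 \<longleftrightarrow> n \<le> 2" for n :: nat
    by auto
  show ?thesis
    unfolding roman_dominating_def pverts_mycielskian
    by (simp add: ball_Un bex_Un parcs_mycielskian[OF assms] le2) blast
qed

lemma roman_weight_mycielskian:
  assumes "finite (pverts G)"
  shows "roman_weight (mycielskian G) g =
    (\<Sum>v\<in>pverts G. g (Base v) + g (Shadow v)) + g Apex"
proof -
  have "roman_weight (mycielskian G) g =
      sum g (Base ` pverts G) + sum g (Shadow ` pverts G) + g Apex"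
    unfolding roman_weight_def pverts_mycielskian
    using assms by (subst sum.union_disjoint; auto)+
  also have "\<dots> = (\<Sum>v\<in>pverts G. g (Base v)) + (\<Sum>v\<in>pverts G. g (Shadow v)) + g Apex"
    by (simp add: sum.reindex inj_on_def)
  finally show ?thesis
    by (simp add: sum.distrib)
qed

text \<open>Arcs are symmetric, so an out-neighbour of value 2 is all that non-isolation in the
  induced subgraph requires.\<close>

lemma special_roman_graph_iff:
  assumes "pair_graph G"
  shows "special_roman_graph G \<longleftrightarrow>
    (\<exists>f. minimum_roman_dominating G f \<and> (\<forall>v\<in>pverts G. f v \<noteq> 1) \<and>
      (\<forall>v\<in>pverts G. f v = 2 \<longrightarrow> (\<exists>w\<in>pverts G. (v, w) \<in> parcs G \<and> f w = 2)))"
proof -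
  interpret pair_graph G by fact
  have sym: "(v, w) \<in> parcs G \<longleftrightarrow> (w, v) \<in> parcs G" for v w
    using arcs_symmetric by blast
  have "isolated_vertex (with_proj G \<restriction> roman_part G f 2) v \<longleftrightarrow>
      v \<in> pverts G \<and> f v = 2 \<and> \<not> (\<exists>w\<in>pverts G. (v, w) \<in> parcs G \<and> f w = 2)" for f v
    by (auto simp: isolated_vertex_def roman_part_def arcs_ends_def arc_to_ends_def
        induce_subgraph_def sym image_iff)
  then show ?thesis
    by (auto simp: special_roman_graph_def roman_part_def)
qed

text \<open>\<open>Shadow v\<close> has the same base neighbours as \<open>Base v\<close>. It is
  dominated like \<open>v\<close> if \<open>f v = 0\<close>, and by a neighbour of \<open>v\<close>
  inside the set of value 2 if \<open>f v = 2\<close>.\<close>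

lemma roman_number_mycielskian_le_if_special:
  assumes "pair_graph G" "special_roman_graph G"
  shows "roman_number (mycielskian G) \<le> roman_number G + 1"
proof -
  interpret pair_graph G by fact
  obtain f where f: "roman_dominating G f" "roman_weight G f = roman_number G"
    and no1: "\<forall>v\<in>pverts G. f v \<noteq> 1"
    and nbr: "\<forall>v\<in>pverts G. f v = 2 \<longrightarrow> (\<exists>w\<in>pverts G. (v, w) \<in> parcs G \<and> f w = 2)"
    using assms(2)
    unfolding special_roman_graph_iff[OF assms(1)] minimum_roman_dominating_def by blast
  define g where "g x = (case x of Base v \<Rightarrow> f v | Shadow v \<Rightarrow> 0 | Apex \<Rightarrow> 1)" for x
  have f2: "\<forall>v\<in>pverts G. f v = 0 \<or> f v = 2"
    using f(1) no1 by (auto simp: roman_dominating_def)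
  have f0: "\<forall>v\<in>pverts G. f v = 0 \<longrightarrow> (\<exists>w\<in>pverts G. (v, w) \<in> parcs G \<and> f w = 2)"
    using f(1) by (auto simp: roman_dominating_def)
  have "roman_dominating (mycielskian G) g"
    unfolding roman_dominating_mycielskian_iff[OF assms(1)] g_def
    using f2 f0 nbr by force
  moreover have "roman_weight (mycielskian G) g = roman_number G + 1"
    using f(2) by (simp add: roman_weight_mycielskian g_def roman_weight_def[of G])
  ultimately show ?thesis
    using roman_number_le_weight by metis
qed

text \<open>Both lower bounds come out of one case analysis on \<open>g Apex\<close>; the bound 2 is
  what excludes equality for graphs that are not special.\<close>

lemma roman_weight_mycielskian_ge:
  assumes G: "pair_graph G" and g: "roman_dominating (mycielskian G) g"
  shows "roman_weight (mycielskian G) g \<ge> roman_number G + (if special_roman_graph G then 1 else 2)"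
proof -
  interpret pair_graph G by fact
  define b s where "b v = g (Base v)" and "s v = g (Shadow v)" for v
  have bs2: "b v \<le> 2" "s v \<le> 2" if "v \<in> pverts G" for v
    using g that unfolding roman_dominating_mycielskian_iff[OF G] b_def s_def by blast+
  have apex2: "g Apex \<le> 2"
    using g unfolding roman_dominating_mycielskian_iff[OF G] by blast
  have b0: "\<exists>w\<in>pverts G. (v, w) \<in> parcs G \<and> (b w = 2 \<or> s w = 2)"
    if "v \<in> pverts G" "b v = 0" for v
    using g that unfolding roman_dominating_mycielskian_iff[OF G] b_def s_def by blast
  have s0: "\<exists>w\<in>pverts G. (v, w) \<in> parcs G \<and> b w = 2"
    if "v \<in> pverts G" "s v = 0" "g Apex \<noteq> 2" for v
    using g that unfolding roman_dominating_mycielskian_iff[OF G] b_def s_def by blast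
  have weight: "roman_weight (mycielskian G) g = (\<Sum>v\<in>pverts G. b v + s v) + g Apex"
    by (simp add: roman_weight_mycielskian b_def s_def)
  show ?thesis
  proof (cases "g Apex = 2")
    case True
    \<comment> \<open>Base neighbours and shadow neighbours of \<open>Base v\<close> both lie over
      neighbours of \<open>v\<close>.\<close>
    define h where "h v = max (b v) (s v)" for v
    have "roman_dominating G h"
      unfolding roman_dominating_def
    proof (intro conjI ballI impI)
      fix v assume v: "v \<in> pverts G"
      show "h v \<in> {0, 1, 2}"
        using bs2[OF v] by (auto simp: h_def)
      assume "h v = 0"
      then obtain w where "w \<in> pverts G" "(v, w) \<in> parcs G" "b w = 2 \<or> s w = 2"
        using b0[OF v] by (auto simp: h_def)
      moreover from this have "h w = 2"
        using bs2[of w] by (auto simp: h_def)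
      ultimately show "\<exists>w\<in>pverts G. v \<rightarrow>\<^bsub>G\<^esub> w \<and> h w = 2"
        by auto
    qed
    then have "roman_number G \<le> (\<Sum>v\<in>pverts G. h v)"
      using roman_number_le_weight unfolding roman_weight_def by blast
    also have "\<dots> \<le> (\<Sum>v\<in>pverts G. b v + s v)"
      by (rule sum_mono) (simp add: h_def)
    finally show ?thesis
      using weight True by simp
  next
    case apex: False
    define dom where "dom v \<longleftrightarrow> (\<exists>w\<in>pverts G. (v, w) \<in> parcs G \<and> b w = 2)" for v
    define h :: "'a \<Rightarrow> nat" where "h v = (if b v = 2 then 2 else if dom v then 0 else 1)" for v
    have h: "roman_dominating G h"
      by (auto simp: roman_dominating_def h_def dom_def)
    then have number: "roman_number G \<le> (\<Sum>v\<in>pverts G. h v)"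
      using roman_number_le_weight unfolding roman_weight_def by blast
    have dom: "dom v" if "v \<in> pverts G" "s v = 0" for v
      using s0[OF that apex] by (simp add: dom_def)
    \<comment> \<open>Only an undominated vertex gets value 1, and there \<open>s v\<close> is
      positive and pays for it.\<close>
    have le: "h v \<le> b v + s v" if "v \<in> pverts G" for v
      using dom[OF that] by (cases "s v = 0") (auto simp: h_def)
    show ?thesis
    proof (cases "g Apex = 0")
      case True
      obtain w where w: "w \<in> pverts G" "s w = 2"
        using g True unfolding roman_dominating_mycielskian_iff[OF G] s_def by blast
      text \<open>Two units of slack: both at \<open>w\<close>, or a second one at a vertex whose shadow dominates \<open>w\<close>.\<close>
      obtain x where x: "x \<in> pverts G"
        and slack: "\<And>v. v \<in> pverts G \<Longrightarrow>
          h v + ((if v = w then 1 else 0) + (if v = x then 1 else 0)) \<le> b v + s v"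
      proof (cases "b w = 0 \<and> \<not> dom w")
        case True
        \<comment> \<open>No base vertex of value 2 dominates \<open>Base w\<close>, so a shadow
          does.\<close>
        then obtain x where "x \<in> pverts G" "(w, x) \<in> parcs G" "s x = 2"
          using b0[OF w(1)] by (auto simp: dom_def)
        moreover from this have "x \<noteq> w"
          using pair_no_loops by fastforce
        moreover have "h v + 1 \<le> b v + s v" if "s v = 2" for v
          using that by (simp add: h_def)
        ultimately show ?thesis
          using that[of x] le w by auto
      next
        case False
        \<comment> \<open>Here \<open>h w \<le> b w\<close>, so all of \<open>s w = 2\<close> is
          slack.\<close>
        then have "h w + 2 \<le> b w + s w"
          using w(2) by (auto simp: h_def)
        then show ?thesis
          using that[of w] le w(1) by auto
      qed
      have "(\<Sum>v\<in>pverts G. h v) + 2 =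
          (\<Sum>v\<in>pverts G. h v + ((if v = w then 1 else 0) + (if v = x then 1 else 0)))"
        using w(1) x by (simp add: sum.distrib)
      also have "\<dots> \<le> (\<Sum>v\<in>pverts G. b v + s v)"
        by (rule sum_mono) (rule slack)
      finally show ?thesis
        using number weight by simp
    next
      case False
      with apex apex2 have apex1: "g Apex = 1"
        by simp
      have sum_le: "(\<Sum>v\<in>pverts G. h v) \<le> (\<Sum>v\<in>pverts G. b v + s v)"
        by (rule sum_mono) (rule le)
      have "special_roman_graph G" if tight: "(\<Sum>v\<in>pverts G. b v + s v) = roman_number G"
      proof -
        \<comment> \<open>The sum of \<open>h\<close> is squeezed between
          \<open>roman_number G\<close> and the tight sum, so the pointwise bound \<open>le\<close>
          is an equality everywhere.\<close>
        have sum_eq: "(\<Sum>v\<in>pverts G. h v) = (\<Sum>v\<in>pverts G. b v + s v)"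
          using tight sum_le number by simp
        have eq: "h v = b v + s v" if "v \<in> pverts G" for v
          using sum_mono_inv[OF sum_eq le that] by simp
        have s_ne2: "s v \<noteq> 2" if "v \<in> pverts G" for v
          using eq[OF that] by (auto simp: h_def split: if_splits)
        \<comment> \<open>Value 1 would mean \<open>b v = 0\<close> with no neighbour of base value
          2, so only a shadow of value 2 could dominate \<open>Base v\<close>; \<open>s_ne2\<close>
          forbids it.\<close>
        have "h v \<noteq> 1" if v: "v \<in> pverts G" for v
        proof
          assume h1: "h v = 1"
          then have "\<not> dom v"
            by (auto simp: h_def split: if_splits)
          moreover from this have "b v = 0"
            using dom[OF v] eq[OF v] h1 by (cases "s v = 0") auto
          ultimately show False
            using b0[OF v] s_ne2 by (auto simp: dom_def)
        qed
        moreover have "\<exists>w\<in>pverts G. (v, w) \<in> parcs G \<and> h w = 2"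
          if v: "v \<in> pverts G" and "h v = 2" for v
        proof -
          \<comment> \<open>Here \<open>b v = 2\<close> already uses up \<open>h v\<close>; the base
            vertex dominating \<open>Shadow v\<close> is then the required neighbour.\<close>
          have "s v = 0"
            using eq[OF v] \<open>h v = 2\<close> by (auto simp: h_def split: if_splits)
          from dom[OF v this] show ?thesis
            by (auto simp: dom_def h_def)
        qed
        moreover have "minimum_roman_dominating G h"
          using h sum_eq tight by (simp add: minimum_roman_dominating_def roman_weight_def)
        ultimately show ?thesis
          unfolding special_roman_graph_iff[OF G] by blast
      qed
      then show ?thesis
        using weight apex1 number sum_le by fastforce
    qed
  qed
qed

theorem theorem5:
  fixes G :: "'a pair_pre_digraph"
  assumes "pair_graph G"
  shows "roman_number (mycielskian G) = roman_number G + 1 \<longleftrightarrow> special_roman_graph G"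
proof -
  obtain g where "roman_dominating (mycielskian G) g"
    and "roman_weight (mycielskian G) g = roman_number (mycielskian G)"
    using minimum_roman_dominating_exists unfolding minimum_roman_dominating_def by blast
  then have "roman_number (mycielskian G) \<ge>
      roman_number G + (if special_roman_graph G then 1 else 2)"
    using roman_weight_mycielskian_ge[OF assms] by metis
  then show ?thesis
    using roman_number_mycielskian_le_if_special[OF assms] by (auto split: if_splits)
qed

end
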